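(* Let $g>1$ be an integer, and let $f(X)\in\mathbb{Z}[X]$ be a polynomial of degree $\deg f\ge 3$ with a positive leading coefficient and no multiple roots in its splitting field. Put $u(n)=f(g^n)$ for $n\ge 1$. Let $\alpha>0$ be a real number for which $$ \left|\left\{\ell\le z:\ \ell \text{ is prime and } P^+(\ell-1)\ge \ell^{\alpha}\right\}\right|\gg \frac{z}{\log z} $$ for all sufficiently large $z$, where the implied constant depends only on $\alpha$. Then for $M\in\mathbb{Z}$, integers $N\ge1$ and $S\ge 1$, $$ \mathcal{Q}_u(M,N;S)\le \begin{cases} S^{1-1/(4\alpha)}N^{1/(2\alpha)+o(1)} & \text{if } S\le N^{2(1-\alpha)/(1+3\alpha)},\\ S^{1/2}N^{(3-\alpha)/(1+3\alpha)+o(1)} & \text{if } N^{2(1-\alpha)/(1+3\alpha)}<S\le N^{4(1-\alpha)/(1+3\alpha)},\\ S^{3/(3+\alpha)}N^{(3-\alpha)/(3+\alpha)+o(1)} & \text{if } N^{4(1-\alpha)/(1+3\alpha)}<S\le N^{2\alpha/3}, \end{cases} $$ as $N\to\infty$, where the functions of $N$ implied by $o(1)$ depend only on $f$, $g$ and $\alpha$.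
   Context: $P^+(k)$ denotes the largest prime divisor of an integer $k\ge 2$. For $M,N,s\in\mathbb{Z}$ with $N\ge1$ and $s$ squarefree, $Q_u(M,N;s)$ denotes the number of integers $n\in[M+1,M+N]$ (with $n\ge 1$, where $u(n)$ is defined) for which $\mathbb{Q}(\sqrt{u(n)})=\mathbb{Q}(\sqrt{s})$. Put $$\mathcal{Q}_u(M,N;S)=\sum_{\substack{1\le s\le S\\ s\text{ squarefree}}}Q_u(M,N;s).$$ The notation $B\gg A$ means $|A|\le cB$ for some constant $c>0$ (the implied constant). *)

theory Defs
  imports
    "HOL-Algebra.Generated_Fields"
    "HOL-Algebra.Algebraic_Closure_Type"
    "HOL-Computational_Algebra.Computational_Algebra"
    "HOL-Library.Landau_Symbols"
    Complex_Main
begin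

text \<open>The value is only meaningful for \<open>k \<ge> 2\<close>; otherwise the maximum is over the empty set.\<close>
definition largest_prime_divisor :: "nat \<Rightarrow> nat" where
  "largest_prime_divisor k = Max (prime_factors k)"

text \<open>
  The field \<open>\<rat>(\<surd>d)\<close> as a subfield of the complex numbers. Every subfield contains the
  rationals, so adjoining the square root to the prime field needs no further generators.
  For \<open>d < 0\<close> the root is imaginary, and for a perfect square \<open>d\<close> (including \<open>0\<close>) the field is
  \<open>\<rat>\<close> itself.
\<close>
definition quadratic_field :: "int \<Rightarrow> complex set" where
  "quadratic_field d = generate_field ring_of_type_algebra {csqrt (of_int d)}"

definition quad_count :: "(nat \<Rightarrow> int) \<Rightarrow> int \<Rightarrow> nat \<Rightarrow> int \<Rightarrow> nat" where
  "quad_count u M N s =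
     card {n :: nat. n \<ge> 1 \<and> int n \<in> {M + 1..M + int N} \<and>
                     quadratic_field (u n) = quadratic_field s}"

definition quad_count_total :: "(nat \<Rightarrow> int) \<Rightarrow> int \<Rightarrow> nat \<Rightarrow> nat \<Rightarrow> nat" where
  "quad_count_total u M N S = (\<Sum>s | s \<in> {1..int S} \<and> squarefree s. quad_count u M N s)"

text \<open>
  The guard \<open>l > 2\<close> makes the largest prime divisor of \<open>l - 1\<close> meaningful; it discards one prime.
\<close>
definition shifted_prime_count :: "real \<Rightarrow> real \<Rightarrow> nat" where
  "shifted_prime_count \<alpha> z =
     card {l :: nat. prime l \<and> l > 2 \<and> real l \<le> z \<and>
                     real (largest_prime_divisor (l - 1)) \<ge> real l powr \<alpha>}"

end

theory Submission
  imports Defs "HOL-Real_Asymp.Real_Asymp"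
begin

text \<open>
  The number of \<open>n\<close> attached to a single squarefree \<open>s\<close> is only logarithmic in \<open>N\<close>, uniformly in
  \<open>s\<close> and \<open>M\<close>. The hypothesis on shifted primes forces \<open>\<alpha> < 1\<close>, and then the trivial sum over
  \<open>s \<le> S\<close> is below all three bounds.

  Split \<open>n = 2 k + r\<close> and put \<open>F(x) = f(g\<^sup>r x\<^sup>2)\<close>, of degree \<open>2 d\<close>. Completing the square gives a
  polynomial \<open>P\<close> of degree \<open>d\<close> with \<open>\<surd>F(x) = P(x) + O(1/x)\<close>. Suppose \<open>F(g\<^sup>k) = s y(k)\<^sup>2\<close> for
  \<open>2 d + 1\<close> values of \<open>k\<close> in a short window \<open>[k0, (1 + \<delta>) k0]\<close>. Lagrange interpolation through
  \<open>d + 1\<close> of the points reproduces \<open>P\<close>, so it predicts each other \<open>y(k)\<close> up to an error that is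
  tiny compared with its denominator, because the denominator depends only on differences of the
  exponents; hence the prediction is exact. Thus all \<open>y(k)\<close> are values of one polynomial \<open>p\<close> of
  degree at most \<open>d\<close>, and \<open>F - s p\<^sup>2\<close> has more zeros than its degree, so \<open>F = s p\<^sup>2\<close>. This
  contradicts that \<open>F\<close> has simple roots away from \<open>0\<close>. So each such window holds at most \<open>2 d\<close>
  solutions, and \<open>O(1 + log N)\<close> windows cover an interval of length \<open>N\<close>.
\<close>

section \<open>Equality of quadratic fields\<close>

lemma inv_ring_of_type_algebra:
  fixes h :: "'a::field"
  shows "\<ominus>\<^bsub>ring_of_type_algebra\<^esub> h = - h"
    and "h \<noteq> 0 \<Longrightarrow> inv\<^bsub>ring_of_type_algebra\<^esub> h = inverse h"
proof -
  interpret K: field "ring_of_type_algebra :: 'a ring" by rule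
  show "\<ominus>\<^bsub>ring_of_type_algebra\<^esub> h = - h"
    by (rule K.sum_zero_eq_neg [symmetric]) (auto simp: ring_of_type_algebra_def)
  show "inv\<^bsub>ring_of_type_algebra\<^esub> h = inverse h" if "h \<noteq> 0"
    by (rule K.comm_inv_char) (use that in \<open>auto simp: ring_of_type_algebra_def\<close>)
qed

text \<open>Multiplication by the conjugate \<open>p - q * r\<close>. Since \<open>r\<close> may be
  rational, the conjugate can vanish; then \<open>p + q * r\<close> equals the rational number
  \<open>2 * p\<close>.\<close>

lemma inverse_in_Rats_adjoin:
  fixes r p q :: real
  assumes "r ^ 2 \<in> \<rat>" "p \<in> \<rat>" "q \<in> \<rat>" "p + q * r \<noteq> 0"
  shows "\<exists>p'\<in>\<rat>. \<exists>q'\<in>\<rat>. inverse (p + q * r) = p' + q' * r"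
proof (cases "p - q * r = 0")
  case True
  have "p + q * r = 2 * p" using True by simp
  hence "inverse (p + q * r) = inverse (2 * p) + 0 * r" by simp
  moreover have "inverse (2 * p) \<in> \<rat>" using assms by (intro Rats_inverse Rats_mult) auto
  ultimately show ?thesis using Rats_0 by blast
next
  case False
  define D where "D = p ^ 2 - q ^ 2 * r ^ 2"
  have D: "D = (p + q * r) * (p - q * r)" by (simp add: D_def power2_eq_square algebra_simps)
  have "D \<noteq> 0" using D False assms(4) by simp
  have "inverse (p + q * r) = (p - q * r) / D"
    unfolding D using False assms(4) by (simp add: inverse_eq_divide)
  hence "inverse (p + q * r) = p / D + (- q / D) * r"
    by (simp add: diff_divide_distrib)
  moreover have "D \<in> \<rat>" unfolding D_def using assms by auto
  ultimately show ?thesis using assms by (intro bexI[of _ "p / D"] bexI[of _ "- q / D"]) auto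
qed

text \<open>The square of the root is rational, so the numbers \<open>p + q * r\<close> are closed
  under all field operations, and induction over the generation of the field stays among them. For
  \<open>d \<ge> 0\<close> the root is real, so the computations take place in the reals.\<close>

lemma quadratic_field_elem:
  assumes "d \<ge> 0" "h \<in> quadratic_field d"
  shows "\<exists>p\<in>\<rat>. \<exists>q\<in>\<rat>. h = complex_of_real (p + q * sqrt (of_int d))"
proof -
  define r where "r = sqrt (real_of_int d)"
  have r2: "r ^ 2 = real_of_int d" using assms(1) by (simp add: r_def)
  have "h \<in> generate_field ring_of_type_algebra {complex_of_real r}"
    using assms csqrt_of_real_nonneg[of "of_int d"] by (simp add: quadratic_field_def r_def)
  hence "\<exists>p\<in>\<rat>. \<exists>q\<in>\<rat>. h = complex_of_real (p + q * r)"
  proof (induction rule: generate_field.induct)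
    case one
    show ?case by (intro bexI[of _ 1] bexI[of _ 0]) (auto simp: ring_of_type_algebra_def)
  next
    case (incl h)
    thus ?case by (intro bexI[of _ 0] bexI[of _ 1]) auto
  next
    case (a_inv h)
    then obtain p q where "p \<in> \<rat>" "q \<in> \<rat>" "h = complex_of_real (p + q * r)" by blast
    thus ?case
      by (intro bexI[of _ "-p"] bexI[of _ "-q"]) (auto simp: inv_ring_of_type_algebra)
  next
    case (m_inv h)
    then obtain p q where pq: "p \<in> \<rat>" "q \<in> \<rat>" "h = complex_of_real (p + q * r)" by blast
    have h0: "h \<noteq> 0" using m_inv by (simp add: ring_of_type_algebra_def)
    hence "p + q * r \<noteq> 0" using pq(3) by (metis of_real_0)
    then obtain p' q' where "p' \<in> \<rat>" "q' \<in> \<rat>" "inverse (p + q * r) = p' + q' * r"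
      using inverse_in_Rats_adjoin[of r p q] pq r2 by auto
    moreover have "inverse h = complex_of_real (inverse (p + q * r))"
      using pq by (simp only: of_real_inverse)
    ultimately show ?case using h0 by (metis inv_ring_of_type_algebra(2))
  next
    case (eng_add h1 h2)
    then obtain p q p' q' where
      "p \<in> \<rat>" "q \<in> \<rat>" "h1 = complex_of_real (p + q * r)"
      "p' \<in> \<rat>" "q' \<in> \<rat>" "h2 = complex_of_real (p' + q' * r)" by blast
    thus ?case
      by (intro bexI[of _ "p + p'"] bexI[of _ "q + q'"])
         (auto simp: ring_of_type_algebra_def algebra_simps)
  next
    case (eng_mult h1 h2)
    then obtain p q p' q' where pq:
      "p \<in> \<rat>" "q \<in> \<rat>" "h1 = complex_of_real (p + q * r)"
      "p' \<in> \<rat>" "q' \<in> \<rat>" "h2 = complex_of_real (p' + q' * r)" by blast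
    have "(p + q * r) * (p' + q' * r) = (p * p' + q * q' * r ^ 2) + (p * q' + q * p') * r"
      by (simp add: power2_eq_square algebra_simps)
    hence "h1 * h2 = complex_of_real ((p * p' + q * q' * of_int d) + (p * q' + q * p') * r)"
      using pq r2 by (metis of_real_mult)
    moreover have "h1 \<otimes>\<^bsub>ring_of_type_algebra\<^esub> h2 = h1 * h2"
      by (simp add: ring_of_type_algebra_def)
    moreover have "p * p' + q * q' * of_int d \<in> \<rat>" "p * q' + q * p' \<in> \<rat>" using pq by auto
    ultimately show ?case by (metis (no_types))
  qed
  thus ?thesis by (simp add: r_def)
qed

lemma csqrt_in_quadratic_field: "csqrt (of_int d) \<in> quadratic_field d"
  unfolding quadratic_field_def by (rule generate_field.incl) simp

lemma Rats_sqrt_int_imp_Ints: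
  fixes x :: real
  assumes "x \<in> \<rat>" "x ^ 2 = of_int a"
  shows "\<exists>m. x = of_int m"
proof -
  obtain m n where mn: "n > 0" "coprime m n" "x = of_int m / of_int n"
    using assms(1) by (metis Rats_cases')
  have "real_of_int (m ^ 2) = real_of_int (a * n ^ 2)"
    using assms(2) mn by (simp add: field_simps)
  hence "m ^ 2 = a * n ^ 2" by (simp only: of_int_eq_iff)
  hence "n ^ 2 dvd m ^ 2" by simp
  hence "n dvd m" by simp
  hence "n dvd 1" using mn(2) by (metis coprime_common_divisor dvd_refl)
  hence "n = 1" using mn(1) by simp
  with mn(3) show ?thesis by auto
qed

text \<open>The square of \<open>p + q * sqrt b\<close> is an integer, so an irrational
  \<open>sqrt b\<close> must have coefficient zero in it, that is \<open>p * q = 0\<close>. The case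
  \<open>q = 0\<close> is excluded by using the equality of the fields in the other direction, and
  squarefreeness of \<open>b\<close> forces the denominator of \<open>q\<close> to be 1.\<close>

lemma same_quadratic_field_imp_square_multiple:
  assumes "quadratic_field a = quadratic_field b" "b \<ge> 1" "squarefree b"
  shows "\<exists>y. a = b * y ^ 2"
proof -
  define r where "r = sqrt (real_of_int b)"
  have r2: "r ^ 2 = of_int b" using assms by (simp add: r_def)
  have "csqrt (of_int a) \<in> quadratic_field b" using csqrt_in_quadratic_field[of a] assms(1) by simp
  then obtain p q where pq: "p \<in> \<rat>" "q \<in> \<rat>" "csqrt (of_int a) = complex_of_real (p + q * r)"
    using quadratic_field_elem[of b "csqrt (of_int a)"] assms(2) unfolding r_def by auto
  define w where "w = p + q * r"
  have "complex_of_int a = complex_of_real (w ^ 2)"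
    using pq by (metis w_def of_real_power power2_csqrt)
  hence w2: "w ^ 2 = of_int a" by (metis of_real_eq_iff of_real_of_int_eq)
  have a0: "a \<ge> 0" using w2 by (metis of_int_0_le_iff zero_le_power2)
  have expand: "2 * (p * q) * r = of_int a - p ^ 2 - q ^ 2 * of_int b"
    using w2 r2[symmetric] unfolding w_def by (simp add: power2_eq_square algebra_simps)
  show ?thesis
  proof (cases "r \<in> \<rat>")
    case True
    \<comment> \<open>A squarefree perfect square is 1, so the common field is that of the rationals
      and \<open>a\<close> itself is a square.\<close>
    then obtain t where t: "r = of_int t" using Rats_sqrt_int_imp_Ints r2 by blast
    have "real_of_int (t ^ 2) = of_int b" using r2 t by simp
    hence tb: "t ^ 2 = b" by (simp only: of_int_eq_iff)
    hence "t dvd 1" using assms(3) by (auto simp: squarefree_def)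
    hence "\<bar>t\<bar> = 1" by simp
    hence "t ^ 2 = 1" by (metis one_power2 power2_abs)
    hence b1: "b = 1" using tb by simp
    have "w \<in> \<rat>" unfolding w_def using pq True by auto
    then obtain m where "w = of_int m" using Rats_sqrt_int_imp_Ints w2 by blast
    hence "real_of_int (m ^ 2) = of_int a" using w2 by simp
    thus ?thesis using b1 by (metis mult_1 of_int_eq_iff)
  next
    case False
    have "p * q = 0"
    proof (rule ccontr)
      assume nz: "p * q \<noteq> 0"
      hence "r = (of_int a - p ^ 2 - q ^ 2 * of_int b) / (2 * (p * q))"
        using expand by (simp add: field_simps)
      also have "\<dots> \<in> \<rat>" using pq by auto
      finally show False using False by blast
    qed
    \<comment> \<open>\<open>q = 0\<close> would make \<open>sqrt a\<close> rational, so the field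
      of \<open>a\<close> could not contain the irrational \<open>r\<close>.\<close>
    have "q \<noteq> 0"
    proof
      assume "q = 0"
      hence "sqrt (of_int a) = \<bar>p\<bar>" using w2[symmetric] by (simp add: w_def)
      hence "sqrt (of_int a) \<in> \<rat>" using pq(1) by simp
      moreover have "complex_of_real r \<in> quadratic_field a"
        using csqrt_in_quadratic_field[of b] csqrt_of_real_nonneg[of "of_int b"] assms
        by (simp add: r_def)
      then obtain p' q' where "p' \<in> \<rat>" "q' \<in> \<rat>"
        "complex_of_real r = complex_of_real (p' + q' * sqrt (of_int a))"
        using quadratic_field_elem[OF a0] by blast
      moreover from this have "r = p' + q' * sqrt (of_int a)" by (simp only: of_real_eq_iff)
      ultimately show False using False by simp
    qed
    hence "p = 0" using \<open>p * q = 0\<close> by simp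
    hence aq: "of_int a = q ^ 2 * of_int b" using expand by simp
    obtain m n where mn: "n > 0" "coprime m n" "q = of_int m / of_int n"
      using pq(2) by (metis Rats_cases')
    have "real_of_int a = (of_int m / of_int n) ^ 2 * of_int b" using aq mn(3) by simp
    hence "real_of_int (a * n ^ 2) = real_of_int (m ^ 2 * b)"
      using mn(1) by (simp add: power_divide)
    hence e: "a * n ^ 2 = m ^ 2 * b" by (simp only: of_int_eq_iff)
    hence "n ^ 2 dvd m ^ 2 * b" by (metis dvd_triv_right)
    moreover have "coprime (n ^ 2) (m ^ 2)" using mn(2) by (simp add: coprime_commute)
    ultimately have "n ^ 2 dvd b" by (simp add: coprime_dvd_mult_right_iff)
    hence "n dvd 1" using assms(3) by (auto simp: squarefree_def)
    hence "n = 1" using mn(1) by simp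
    thus ?thesis using e by (auto simp: mult.commute)
  qed
qed

section \<open>Interpolation and the polynomial part of a square root\<close>

text \<open>The field is arbitrary because the interpolant is used over the reals, to estimate
  errors, and over the complex numbers, to compare it with \<open>F\<close>. The explicit weights
  stay in the conclusion since their sizes and denominators matter later.\<close>

lemma lagrange_polynomial:
  fixes x y :: "'i \<Rightarrow> 'a::field"
  assumes "finite U" "inj_on x U"
  obtains p where "degree p \<le> card U - 1"
    and "\<And>t. poly p t = (\<Sum>a\<in>U. y a * (\<Prod>b\<in>U - {a}. (t - x b) / (x a - x b)))"
    and "\<And>a. a \<in> U \<Longrightarrow> poly p (x a) = y a"
proof -
  define p where
    "p = (\<Sum>a\<in>U. smult (y a) (\<Prod>b\<in>U - {a}. smult (inverse (x a - x b)) [:- x b, 1:]))"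
  have p: "poly p t = (\<Sum>a\<in>U. y a * (\<Prod>b\<in>U - {a}. (t - x b) / (x a - x b)))" for t
    unfolding p_def by (simp add: poly_sum poly_prod divide_inverse algebra_simps)
  have "degree p \<le> card U - 1"
    unfolding p_def
  proof (rule degree_sum_le[OF assms(1)])
    fix a assume a: "a \<in> U"
    have "degree (\<Prod>b\<in>U - {a}. smult (inverse (x a - x b)) [:- x b, 1:])
        \<le> (\<Sum>b\<in>U - {a}. degree (smult (inverse (x a - x b)) [:- x b, 1:]))"
      using assms(1) by (intro order.trans[OF degree_prod_sum_le]) auto
    also have "\<dots> \<le> (\<Sum>b\<in>U - {a}. 1)"
      by (intro sum_mono order.trans[OF degree_smult_le]) simp
    also have "\<dots> = card U - 1" using a by simp
    finally show "degree (smult (y a) (\<Prod>b\<in>U - {a}. smult (inverse (x a - x b)) [:- x b, 1:]))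
        \<le> card U - 1"
      using degree_smult_le order.trans by blast
  qed
  moreover have "poly p (x c) = y c" if c: "c \<in> U" for c
  proof -
    have "(\<Prod>b\<in>U - {a}. (x c - x b) / (x a - x b)) = (if a = c then 1 else 0)" if a: "a \<in> U" for a
    proof (cases "a = c")
      case True
      have "(\<Prod>b\<in>U - {a}. (x c - x b) / (x a - x b)) = (\<Prod>b\<in>U - {a}. 1)"
        using True c assms(2) by (intro prod.cong) (auto dest: inj_onD)
      thus ?thesis using True by simp
    next
      case False
      have "c \<in> U - {a}" "(x c - x c) / (x a - x c) = 0" using False c by auto
      hence "(\<Prod>b\<in>U - {a}. (x c - x b) / (x a - x b)) = 0"
        using assms(1) by (intro prod_zero) blast+
      thus ?thesis using False by simp
    qed
    hence "poly p (x c) = (\<Sum>a\<in>U. y a * (if a = c then 1 else 0))"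
      unfolding p by (intro sum.cong) auto
    also have "\<dots> = (\<Sum>a\<in>U. if a = c then y a else 0)" by (intro sum.cong) auto
    also have "\<dots> = y c" using c assms(1) by simp
    finally show ?thesis .
  qed
  ultimately show ?thesis using that p by blast
qed

lemma lagrange_interpolation:
  fixes x :: "'i \<Rightarrow> 'a::field"
  assumes "finite U" "inj_on x U" "degree P < card U"
  shows "poly P t = (\<Sum>a\<in>U. poly P (x a) * (\<Prod>b\<in>U - {a}. (t - x b) / (x a - x b)))"
proof -
  obtain p where p: "degree p \<le> card U - 1"
    "\<And>t. poly p t = (\<Sum>a\<in>U. poly P (x a) * (\<Prod>b\<in>U - {a}. (t - x b) / (x a - x b)))"
    "\<And>a. a \<in> U \<Longrightarrow> poly p (x a) = poly P (x a)"
    using lagrange_polynomial[OF assms(1,2), of "\<lambda>a. poly P (x a)"] by blast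
  have "card (x ` U) = card U" by (rule card_image[OF assms(2)])
  hence "P = p"
    using p assms(3) by (intro poly_eqI_degree[of "x ` U"]) auto
  thus ?thesis using p(2) by metis
qed

section \<open>The polynomial part of a square root\<close>

text \<open>The coefficients of \<open>P\<close> are found from the top down. After \<open>t\<close>
  steps the remainder vanishes from degree \<open>2 * d - t\<close> on; a correction of degree
  \<open>d - Suc t\<close> affects only degrees up to \<open>2 * d - Suc t\<close>, so nothing
  already cancelled returns.\<close>

lemma complete_square_poly:
  fixes F :: "real poly"
  assumes F: "degree F = 2 * d" "lead_coeff F > 0"
  shows "\<exists>P. degree P = d \<and> lead_coeff P > 0 \<and> (\<forall>i\<ge>d. coeff (F - P ^ 2) i = 0)"
proof -
  have "\<exists>P. degree P = d \<and> lead_coeff P > 0 \<and> (\<forall>i\<ge>2 * d - t. coeff (F - P ^ 2) i = 0)"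
    if "t \<le> d" for t
    using that
  proof (induction t)
    case 0
    define P where "P = monom (sqrt (lead_coeff F)) d"
    have "degree P = d" "lead_coeff P > 0" using F by (auto simp: P_def degree_monom_eq)
    moreover have "coeff (F - P ^ 2) i = 0" if "i \<ge> 2 * d" for i
    proof -
      have "P ^ 2 = monom (lead_coeff F) (2 * d)"
        using F(2) by (simp add: P_def power2_eq_square mult_monom mult_2)
      thus ?thesis using that F(1) by (cases "i = 2 * d") (auto simp: coeff_eq_0)
    qed
    ultimately show ?case by auto
  next
    case (Suc t)
    then obtain P where P: "degree P = d" "lead_coeff P > 0"
      "\<And>i. i \<ge> 2 * d - t \<Longrightarrow> coeff (F - P ^ 2) i = 0" by auto
    define m where "m = d - Suc t"
    \<comment> \<open>The cross term \<open>2 * P * monom c m\<close> contributes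
      \<open>2 * c * lead_coeff P\<close> in degree \<open>m + d\<close>, while the square of the
      new monomial has degree at most \<open>2 * m < m + d\<close>. This \<open>c\<close> therefore
      cancels the top remaining coefficient.\<close>
    define c where "c = coeff (F - P ^ 2) (2 * d - Suc t) / (2 * lead_coeff P)"
    define P' where "P' = P + monom c m"
    have m: "m < d" "2 * d - Suc t = m + d" using Suc.prems by (auto simp: m_def)
    have "degree (monom c m) < degree P" using m P degree_monom_le[of c m] by simp
    hence "degree P' = d" "lead_coeff P' > 0"
      using P m by (auto simp: P'_def degree_add_eq_left)
    moreover have "coeff (F - P' ^ 2) i = 0" if i: "i \<ge> 2 * d - Suc t" for i
    proof -
      have "F - P' ^ 2 = (F - P ^ 2) - (monom c m * P + monom c m * P) - monom c m * monom c m"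
        by (simp add: P'_def power2_eq_square algebra_simps)
      moreover have "coeff (monom c m * P) i = c * coeff P (i - m)"
        "coeff (monom c m * monom c m) i = 0"
        using i m by (auto simp: mult_monom coeff_monom_mult)
      ultimately have "coeff (F - P' ^ 2) i = coeff (F - P ^ 2) i - 2 * (c * coeff P (i - m))"
        by (simp only: coeff_diff coeff_add)
      also have "\<dots> = 0"
      proof (cases "i = 2 * d - Suc t")
        case True
        hence "i - m = d" using m by simp
        thus ?thesis using P True by (simp add: c_def)
      next
        case False
        hence "i \<ge> 2 * d - t" "i - m > d" using i m by auto
        thus ?thesis using P by (simp add: coeff_eq_0)
      qed
      finally show ?thesis .
    qed
    ultimately show ?case by blast
  qed
  from this[of d] show ?thesis by (simp add: mult_2)
qed

text \<open>\<open>C\<close> is chosen so that \<open>C * P + Q\<close> and \<open>C * P - Q\<close>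
  both have a positive coefficient in degree \<open>degree P\<close>, which is then their leading
  one; so both are eventually nonnegative.\<close>

lemma poly_eventually_dominated:
  fixes P Q :: "real poly"
  assumes "degree Q \<le> degree P" "lead_coeff P > 0"
  obtains C x0 where "C \<ge> 0" "\<And>x. x \<ge> x0 \<Longrightarrow> poly P x > 0 \<and> \<bar>poly Q x\<bar> \<le> C * poly P x"
proof -
  define C where "C = (\<bar>coeff Q (degree P)\<bar> + 1) / lead_coeff P"
  have CP: "C * lead_coeff P = \<bar>coeff Q (degree P)\<bar> + 1" using assms(2) by (auto simp: C_def)
  have aux: "\<exists>n. \<forall>x\<ge>n. poly (smult C P + R) x \<ge> 0"
    if R: "degree R \<le> degree P" "\<bar>coeff R (degree P)\<bar> \<le> \<bar>coeff Q (degree P)\<bar>" for R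
  proof -
    have pos: "coeff (smult C P + R) (degree P) > 0" using CP R(2) by simp
    hence "degree P \<le> degree (smult C P + R)" by (intro le_degree) linarith
    moreover have "degree (smult C P + R) \<le> degree P"
      using R(1) by (intro degree_add_le) auto
    ultimately have "degree (smult C P + R) = degree P" by simp
    hence "lead_coeff (smult C P + R) > 0" using pos by simp
    thus ?thesis using poly_pinfty_gt_lc by (meson less_imp_le order.trans)
  qed
  obtain n1 where n1: "\<forall>x\<ge>n1. poly P x \<ge> lead_coeff P" using poly_pinfty_gt_lc assms(2) by blast
  obtain n2 where n2: "\<forall>x\<ge>n2. poly (smult C P + Q) x \<ge> 0" using aux[of Q] assms(1) by auto
  obtain n3 where n3: "\<forall>x\<ge>n3. poly (smult C P + - Q) x \<ge> 0" using aux[of "- Q"] assms(1) by auto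
  show ?thesis
  proof (rule that[of C "Max {n1, n2, n3}"])
    show "C \<ge> 0" using assms(2) by (simp add: C_def)
    fix x assume "x \<ge> Max {n1, n2, n3}"
    hence x: "x \<ge> n1" "x \<ge> n2" "x \<ge> n3" by auto
    have "poly P x > 0" using n1 x(1) assms(2) by force
    moreover have "C * poly P x + poly Q x \<ge> 0" using n2 x(2) by simp
    moreover have "C * poly P x - poly Q x \<ge> 0" using n3 x(3) by simp
    ultimately show "poly P x > 0 \<and> \<bar>poly Q x\<bar> \<le> C * poly P x" by linarith
  qed
qed

text \<open>With \<open>R = F - P ^ 2\<close> one has \<open>sqrt F - P = R / (sqrt F + P)\<close>.
  As \<open>R\<close> has no terms from degree \<open>d\<close> on, \<open>x * R\<close> is
  dominated by \<open>P\<close>, which leaves an error of order \<open>1 / x\<close>.\<close>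

lemma sqrt_poly_approx:
  fixes F :: "real poly"
  assumes F: "degree F = 2 * d" "lead_coeff F > 0" "d \<ge> 1"
  obtains P C x0 where "degree P = d" "C \<ge> 0"
    "\<And>x. x \<ge> x0 \<Longrightarrow> \<bar>sqrt (poly F x) - poly P x\<bar> \<le> C / x"
proof -
  obtain P where P: "degree P = d" "lead_coeff P > 0" "\<forall>i\<ge>d. coeff (F - P ^ 2) i = 0"
    using complete_square_poly[OF F(1,2)] by blast
  define R where "R = F - P ^ 2"
  \<comment> \<open>\<open>pCons 0 R\<close> is the polynomial \<open>x * R\<close>.\<close>
  have "degree (pCons 0 R) \<le> degree P"
    using P F(3) by (intro degree_le) (auto simp: R_def coeff_pCons split: nat.splits)
  then obtain C X1 where C: "C \<ge> 0"
    "\<And>x. x \<ge> X1 \<Longrightarrow> poly P x > 0 \<and> \<bar>poly (pCons 0 R) x\<bar> \<le> C * poly P x"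
    using poly_eventually_dominated P(2) by metis
  obtain X2 where X2: "\<forall>x\<ge>X2. poly F x \<ge> lead_coeff F" using poly_pinfty_gt_lc F(2) by blast
  show ?thesis
  proof (rule that[of P C "Max {1, X1, X2}"])
    show "degree P = d" "C \<ge> 0" by fact+
    fix x assume "x \<ge> Max {1, X1, X2}"
    hence x: "x \<ge> 1" "x \<ge> X1" "x \<ge> X2" by auto
    define w where "w = sqrt (poly F x)"
    have F0: "poly F x \<ge> 0" using X2 x(3) F(2) by force
    hence w: "w \<ge> 0" "w ^ 2 = poly F x" by (auto simp: w_def)
    have P0: "poly P x > 0" and CP: "\<bar>x * poly R x\<bar> \<le> C * poly P x" using C(2)[OF x(2)] by auto
    have "poly R x = (w - poly P x) * (w + poly P x)"
      by (simp add: R_def w(2)[symmetric] power2_eq_square algebra_simps)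
    hence "\<bar>w - poly P x\<bar> * (w + poly P x) = \<bar>poly R x\<bar>"
      using w P0 by (simp add: abs_mult)
    moreover have "\<bar>w - poly P x\<bar> * poly P x \<le> \<bar>w - poly P x\<bar> * (w + poly P x)"
      using w by (intro mult_left_mono) auto
    ultimately have "x * (\<bar>w - poly P x\<bar> * poly P x) \<le> x * \<bar>poly R x\<bar>"
      using x by (intro mult_left_mono) auto
    also have "\<dots> \<le> C * poly P x" using CP x by (simp add: abs_mult)
    finally have "x * \<bar>w - poly P x\<bar> \<le> C" using P0 by (simp add: mult.assoc[symmetric])
    thus "\<bar>sqrt (poly F x) - poly P x\<bar> \<le> C / x"
      using x by (simp add: w_def field_simps)
  qed
qed

section \<open>Square multiples at powers of an integer\<close>

lemma poly_map_of_int_eq: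
  "poly (map_poly of_int F) (of_int x :: 'a::comm_ring_1) = of_int (poly F x)"
  by (induction F) (simp_all add: map_poly_pCons)

text \<open>Interpolation reproduces \<open>P\<close> exactly, so only the approximation errors
  \<open>e\<close> contribute to the defect \<open>D\<close>, and \<open>W * D\<close> is an integer
  of absolute value below 1. The first largeness assumption puts all points into the range of the
  approximation, the second makes the final bound less than 1.\<close>

lemma square_values_interpolated:
  fixes F :: "int poly" and P :: "real poly" and g s :: int and y :: "nat \<Rightarrow> int" and C x0 :: real
  assumes g: "g > 1" and s: "s \<ge> 1" and P: "degree P = d" and C: "C \<ge> 0"
    and approx: "\<And>x. x \<ge> x0 \<Longrightarrow> \<bar>sqrt (poly (map_poly of_int F) x) - poly P x\<bar> \<le> C / x"
    and large: "x0 \<le> of_int g ^ k0" "C * (real d + 2) * (of_int g ^ h) ^ (d * (d + 2)) < of_int g ^ k0"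
    and U: "finite U" "card U = d + 1" and window: "insert k U \<subseteq> {k0..k0 + h}"
    and y: "\<And>i. i \<in> insert k U \<Longrightarrow> y i \<ge> 0 \<and> poly F (g ^ i) = s * y i ^ 2"
  shows "real_of_int (y k) = (\<Sum>a\<in>U. of_int (y a) *
           (\<Prod>b\<in>U - {a}. (of_int (g ^ k) - of_int (g ^ b)) / (of_int (g ^ a) - of_int (g ^ b))))"
proof -
  define r where "r = sqrt (real_of_int s)"
  define G where "G = real_of_int g ^ h"
  define N where "N = real_of_int g ^ k0"
  \<comment> \<open>The factor \<open>g ^ k0\<close> cancels from every weight, so sizes and
    denominators depend only on the exponents \<open>i - k0\<close>, which are at most
    \<open>h\<close>.\<close>
  define Z where "Z i = g ^ (i - k0)" for i
  define V where "V a = (\<Prod>b\<in>U - {a}. Z a - Z b)" for a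
  \<comment> \<open>A common denominator of all weights, because \<open>V a\<close> is a denominator
    of \<open>L a\<close>.\<close>
  define W where "W = prod V U"
  define L where "L a = (\<Prod>b\<in>U - {a}. (real_of_int (g ^ k) - of_int (g ^ b)) /
    (of_int (g ^ a) - of_int (g ^ b)))" for a
  define e where "e i = r * of_int (y i) - poly P (of_int (g ^ i))" for i
  define D where "D = real_of_int (y k) - (\<Sum>a\<in>U. of_int (y a) * L a)"
  have r1: "r \<ge> 1" using s by (simp add: r_def)
  have g1: "real_of_int g \<ge> 1" "real_of_int g > 0" using g by auto
  have G1: "G \<ge> 1" unfolding G_def using g1 by simp
  have N0: "N > 0" unfolding N_def using g1 by simp
  have pow: "g ^ i = g ^ k0 * Z i" if "i \<in> insert k U" for i
  proof -
    have "k0 \<le> i" using that window by auto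
    thus ?thesis by (simp add: Z_def flip: power_add)
  qed
  have Z1: "real_of_int (Z i) \<ge> 1" "real_of_int (Z i) \<le> G" if "i \<in> insert k U" for i
  proof -
    have "i \<in> {k0..k0 + h}" using that window by blast
    hence "i - k0 \<le> h" by auto
    thus "real_of_int (Z i) \<le> G" unfolding Z_def G_def using g1 by (simp add: power_increasing)
    show "real_of_int (Z i) \<ge> 1" unfolding Z_def using g1 by simp
  qed
  have Zdiff: "\<bar>real_of_int (Z i - Z j)\<bar> \<le> G" if "i \<in> insert k U" "j \<in> insert k U" for i j
    using Z1[OF that(1)] Z1[OF that(2)] by auto
  have Zinj: "Z a \<noteq> Z b" if "a \<in> U" "b \<in> U" "a \<noteq> b" for a b
  proof -
    have "k0 \<le> a" "k0 \<le> b" using that window by auto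
    hence "a - k0 \<noteq> b - k0" using that by auto
    thus ?thesis unfolding Z_def using g by (simp add: power_inject_exp)
  qed
  have inj: "inj_on (\<lambda>a. real_of_int (g ^ a)) U"
    using g by (intro inj_onI) (simp add: power_inject_exp)
  have L: "L a = (\<Prod>b\<in>U - {a}. of_int (Z k - Z b) / of_int (Z a - Z b))" if a: "a \<in> U" for a
    unfolding L_def
  proof (rule prod.cong[OF refl])
    fix b assume b: "b \<in> U - {a}"
    have "real_of_int g ^ k0 \<noteq> 0" using g1 by simp
    have "real_of_int (g ^ k) - of_int (g ^ b) = real_of_int g ^ k0 * of_int (Z k - Z b)"
         "real_of_int (g ^ a) - of_int (g ^ b) = real_of_int g ^ k0 * of_int (Z a - Z b)"
      using a b by (simp_all add: pow right_diff_distrib)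
    thus "(real_of_int (g ^ k) - of_int (g ^ b)) / (of_int (g ^ a) - of_int (g ^ b))
        = of_int (Z k - Z b) / of_int (Z a - Z b)"
      using g1 by simp
  qed
  have Lbound: "\<bar>L a\<bar> \<le> G ^ d" if a: "a \<in> U" for a
  proof -
    have "\<bar>L a\<bar> = (\<Prod>b\<in>U - {a}. \<bar>real_of_int (Z k - Z b)\<bar> / \<bar>real_of_int (Z a - Z b)\<bar>)"
      unfolding L[OF a] by (simp add: abs_prod)
    also have "\<dots> \<le> G ^ d"
    proof (rule prod_le_power)
      fix b assume b: "b \<in> U - {a}"
      hence "\<bar>Z a - Z b\<bar> \<ge> 1" using Zinj[OF a, of b] by auto
      hence "\<bar>real_of_int (Z a - Z b)\<bar> \<ge> 1" by (metis of_int_1_le_iff of_int_abs)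
      hence "\<bar>real_of_int (Z k - Z b)\<bar> / \<bar>real_of_int (Z a - Z b)\<bar> \<le> \<bar>real_of_int (Z k - Z b)\<bar> / 1"
        by (intro divide_left_mono) auto
      also have "\<dots> \<le> G" using Zdiff[of k b] b by simp
      finally show "0 \<le> \<bar>real_of_int (Z k - Z b)\<bar> / \<bar>real_of_int (Z a - Z b)\<bar> \<and>
        \<bar>real_of_int (Z k - Z b)\<bar> / \<bar>real_of_int (Z a - Z b)\<bar> \<le> G" by simp
    qed (use a U G1 in auto)
    finally show ?thesis .
  qed
  have Wbound: "\<bar>real_of_int W\<bar> \<le> G ^ (d * (d + 1))"
  proof -
    have "\<bar>real_of_int W\<bar> = (\<Prod>a\<in>U. \<Prod>b\<in>U - {a}. \<bar>real_of_int (Z a - Z b)\<bar>)"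
      by (simp add: W_def V_def abs_prod)
    also have "\<dots> \<le> (G ^ d) ^ (d + 1)"
    proof (rule prod_le_power)
      fix a assume a: "a \<in> U"
      have "(\<Prod>b\<in>U - {a}. \<bar>real_of_int (Z a - Z b)\<bar>) \<le> G ^ d"
      proof (rule prod_le_power)
        fix b assume "b \<in> U - {a}"
        thus "0 \<le> \<bar>real_of_int (Z a - Z b)\<bar> \<and> \<bar>real_of_int (Z a - Z b)\<bar> \<le> G"
          using Zdiff[of a b] a by simp
      qed (use a U G1 in auto)
      thus "0 \<le> (\<Prod>b\<in>U - {a}. \<bar>real_of_int (Z a - Z b)\<bar>) \<and>
        (\<Prod>b\<in>U - {a}. \<bar>real_of_int (Z a - Z b)\<bar>) \<le> G ^ d"
        by (simp add: prod_nonneg)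
    qed (use U G1 in auto)
    also have "(G ^ d) ^ (d + 1) = G ^ (d * (d + 1))" by (rule power_mult[symmetric])
    finally show ?thesis .
  qed
  have V0: "V a \<noteq> 0" if a: "a \<in> U" for a
    unfolding V_def using U(1) Zinj[OF a] by (subst prod_zero_iff) auto
  have W0: "W \<noteq> 0" unfolding W_def using U(1) V0 by (subst prod_zero_iff) auto
  have WL: "real_of_int W * L a \<in> \<int>" if a: "a \<in> U" for a
  proof -
    have "W = V a * prod V (U - {a})" unfolding W_def using U(1) a by (rule prod.remove)
    moreover have "L a = of_int (\<Prod>b\<in>U - {a}. Z k - Z b) / of_int (V a)"
      unfolding L[OF a] V_def by (simp only: prod_dividef of_int_prod)
    hence "real_of_int (V a) * L a = of_int (\<Prod>b\<in>U - {a}. Z k - Z b)"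
      using V0[OF a] by simp
    ultimately have "real_of_int W * L a = of_int (prod V (U - {a}) * (\<Prod>b\<in>U - {a}. Z k - Z b))"
      by (simp add: mult.assoc mult.left_commute)
    thus ?thesis by (metis Ints_of_int)
  qed
  have "real_of_int W * D = of_int (W * y k) - (\<Sum>a\<in>U. of_int (y a) * (of_int W * L a))"
    unfolding D_def by (simp add: right_diff_distrib sum_distrib_left mult.left_commute)
  also have "\<dots> \<in> \<int>" by (intro Ints_diff Ints_sum Ints_mult[OF Ints_of_int WL] Ints_of_int)
  finally have int: "real_of_int W * D \<in> \<int>" .
  have ebound: "\<bar>e i\<bar> \<le> C / N" if i: "i \<in> insert k U" for i
  proof -
    have "N \<le> real_of_int (g ^ i)"
      unfolding N_def using i window g1 by (auto intro!: power_increasing)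
    moreover have "sqrt (poly (map_poly of_int F) (real_of_int (g ^ i))) = r * of_int (y i)"
      unfolding poly_map_of_int_eq using y[OF i] by (simp add: r_def real_sqrt_mult)
    ultimately have "\<bar>e i\<bar> \<le> C / real_of_int (g ^ i)"
      using approx[of "real_of_int (g ^ i)"] large(1) unfolding e_def N_def by simp
    also have "\<dots> \<le> C / N"
      using C N0 \<open>N \<le> real_of_int (g ^ i)\<close> by (intro divide_left_mono) auto
    finally show ?thesis .
  qed
  have "poly P (of_int (g ^ k)) = (\<Sum>a\<in>U. poly P (of_int (g ^ a)) * L a)"
    unfolding L_def using lagrange_interpolation[OF U(1) inj, of P "of_int (g ^ k)"] P U(2) by simp
  hence rD: "r * D = e k - (\<Sum>a\<in>U. e a * L a)"
    unfolding D_def e_def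
    by (simp add: algebra_simps sum_subtractf sum_distrib_left)
  \<comment> \<open>\<open>s \<ge> 1\<close> gives \<open>r \<ge> 1\<close>; discarding
    \<open>r\<close> here makes the bound independent of \<open>s\<close>.\<close>
  have "\<bar>D\<bar> \<le> \<bar>r * D\<bar>" using r1 by (simp add: abs_mult mult_right_mono[of 1 r "\<bar>D\<bar>", simplified])
  also have "\<dots> \<le> \<bar>e k\<bar> + (\<Sum>a\<in>U. \<bar>e a * L a\<bar>)"
    unfolding rD using sum_abs[of "\<lambda>a. e a * L a" U] by linarith
  also have "(\<Sum>a\<in>U. \<bar>e a * L a\<bar>) \<le> (\<Sum>a\<in>U. C / N * G ^ d)"
    using ebound Lbound C N0 by (intro sum_mono) (auto simp: abs_mult simp del: times_divide_eq_left intro!: mult_mono)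
  also have "\<dots> = (real d + 1) * (C / N * G ^ d)" using U(2) by simp
  also have "\<bar>e k\<bar> \<le> C / N * G ^ d"
  proof -
    have "C / N * 1 \<le> C / N * G ^ d" using C N0 G1 by (intro mult_left_mono) auto
    thus ?thesis using ebound[of k] by simp
  qed
  finally have "\<bar>D\<bar> \<le> C / N * G ^ d + (real d + 1) * (C / N * G ^ d)" by simp
  also have "\<dots> = (real d + 2) * (C / N * G ^ d)" by (simp only: distrib_right)
  finally have Dbound: "\<bar>D\<bar> \<le> (real d + 2) * (C / N * G ^ d)" .
  have "\<bar>real_of_int W * D\<bar> \<le> G ^ (d * (d + 1)) * ((real d + 2) * (C / N * G ^ d))"
    unfolding abs_mult using Wbound Dbound by (intro mult_mono) (use G1 in auto)
  \<comment> \<open>The exponent adds \<open>d * (d + 1)\<close> from \<open>W\<close> and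
    \<open>d\<close> from a weight; the factor \<open>d + 2\<close> counts the \<open>d + 1\<close>
    nodes and the point \<open>k\<close>.\<close>
  also have "\<dots> = C * (real d + 2) * G ^ (d * (d + 2)) / N"
    by (simp add: algebra_simps flip: power_add)
  also have "\<dots> < 1" using large(2) N0 by (simp add: G_def N_def)
  finally have "real_of_int W * D = 0" using int Ints_nonzero_abs_less1 by blast
  hence "D = 0" using W0 by simp
  thus ?thesis by (simp add: D_def L_def)
qed

text \<open>The interpolant \<open>p\<close> through \<open>d + 1\<close> solutions passes through
  all others, so more than \<open>2 * d\<close> solutions give that many common values of
  \<open>F\<close> and \<open>s * p ^ 2\<close>, both of degree at most \<open>2 * d\<close>.
  \<open>B\<close> and \<open>K\<close> are chosen before \<open>s\<close>, which gives uniformity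
  in \<open>s\<close>.\<close>

lemma few_square_multiples_in_window:
  fixes F :: "int poly" and g :: int
  assumes g: "g > 1" and F: "degree F = 2 * d" "lead_coeff F > 0" "d \<ge> 1"
    and nonsquare: "\<And>c p. map_poly of_int F \<noteq> smult (c :: complex) (p ^ 2)"
  obtains B K :: nat where "B > 0" "K > 0"
    "\<And>s k0 T. s \<ge> 1 \<Longrightarrow> k0 \<ge> K \<Longrightarrow> T \<subseteq> {k0..k0 + k0 div B} \<Longrightarrow>
       \<forall>k\<in>T. \<exists>y. poly F (g ^ k) = s * y ^ 2 \<Longrightarrow> card T \<le> 2 * d"
proof -
  define FR :: "real poly" where "FR = map_poly of_int F"
  have "degree FR = 2 * d" "lead_coeff FR > 0"
    using F by (auto simp: FR_def degree_map_poly lead_coeff_map_poly_nz coeff_map_poly)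
  then obtain P C x0 where P: "degree P = d" "C \<ge> 0"
    "\<And>x. x \<ge> x0 \<Longrightarrow> \<bar>sqrt (poly FR x) - poly P x\<bar> \<le> C / x"
    using sqrt_poly_approx[of FR d] F(3) by blast
  \<comment> \<open>With \<open>h = k0 div B\<close> the factor
    \<open>(g ^ h) ^ (d * (d + 2))\<close> is at most the square root of
    \<open>g ^ k0\<close>.\<close>
  define B where "B = 2 * (d * (d + 2))"
  have g1: "real_of_int g > 1" using g by simp
  \<comment> \<open>From \<open>K\<close> on, the points exceed \<open>x0\<close>, and the remaining
    square root of \<open>g ^ k0\<close> exceeds the constant
    \<open>C * (real d + 2)\<close>.\<close>
  obtain K where K: "max x0 ((C * (real d + 2)) ^ 2) < real_of_int g ^ K"
    using real_arch_pow[OF g1] by blast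
  show ?thesis
  proof (rule that[of B "Suc K"])
    show "B > 0" using F(3) by (simp add: B_def)
    fix s :: int and k0 :: nat and T
    assume s: "s \<ge> 1" and k0: "k0 \<ge> Suc K" and T: "T \<subseteq> {k0..k0 + k0 div B}"
      and "\<forall>k\<in>T. \<exists>y. poly F (g ^ k) = s * y ^ 2"
    then obtain y0 where y0: "\<And>k. k \<in> T \<Longrightarrow> poly F (g ^ k) = s * y0 k ^ 2" by metis
    \<comment> \<open>The approximation concerns the nonnegative square root, so the signs are
      normalised.\<close>
    define y where "y k = \<bar>y0 k\<bar>" for k
    have y: "y k \<ge> 0 \<and> poly F (g ^ k) = s * y k ^ 2" if "k \<in> T" for k
      using y0[OF that] by (simp add: y_def)
    define h where "h = k0 div B"
    define q where "q = real_of_int g ^ (h * (d * (d + 2)))"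
    have gk: "real_of_int g ^ K \<le> of_int g ^ k0" using k0 g1 by (intro power_increasing) auto
    have "q ^ 2 = of_int g ^ (h * B)"
      by (simp add: q_def B_def algebra_simps flip: power_mult)
    also have "\<dots> \<le> of_int g ^ k0" using g1 unfolding h_def by (intro power_increasing) auto
    finally have "(C * (real d + 2) * q) ^ 2 \<le> (C * (real d + 2)) ^ 2 * of_int g ^ k0"
      unfolding power_mult_distrib[of _ q] by (intro mult_left_mono) auto
    also have "\<dots> < of_int g ^ k0 * of_int g ^ k0"
    proof (rule mult_strict_right_mono)
      show "(C * (real d + 2)) ^ 2 < of_int g ^ k0" using K gk by linarith
    qed (use g1 in auto)
    finally have "(C * (real d + 2) * q) ^ 2 < (of_int g ^ k0) ^ 2" by (simp add: power2_eq_square)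
    hence "C * (real d + 2) * q < of_int g ^ k0"
      by (rule power2_less_imp_less) (use g1 in auto)
    hence large: "C * (real d + 2) * (of_int g ^ h) ^ (d * (d + 2)) < of_int g ^ k0"
      by (simp add: q_def power_mult)
    have finT: "finite T" using T finite_subset by blast
    show "card T \<le> 2 * d"
    proof (rule ccontr)
      assume card: "\<not> card T \<le> 2 * d"
      then obtain U where U: "U \<subseteq> T" "card U = d + 1"
        using obtain_subset_with_card_n[of "d + 1" T] by auto
      have finU: "finite U" using U finT finite_subset by blast
      have inj: "inj_on (\<lambda>a. complex_of_int (g ^ a)) T" for T
        using g by (intro inj_onI) (simp add: power_inject_exp flip: of_int_power)
      \<comment> \<open>Taken over the complex numbers, where \<open>nonsquare\<close> is stated;
        the real identity for the \<open>y k\<close> is transported there.\<close>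
      obtain p where p: "degree p \<le> card U - 1"
        "\<And>t. poly p t = (\<Sum>a\<in>U. complex_of_int (y a) *
           (\<Prod>b\<in>U - {a}. (t - of_int (g ^ b)) / (of_int (g ^ a) - of_int (g ^ b))))"
        using lagrange_polynomial[OF finU inj, of "\<lambda>a. complex_of_int (y a)"] by blast
      have py: "poly p (of_int (g ^ k)) = of_int (y k)" if k: "k \<in> T" for k
      proof -
        have "insert k U \<subseteq> T" using k U by blast
        hence "real_of_int (y k) = (\<Sum>a\<in>U. of_int (y a) *
           (\<Prod>b\<in>U - {a}. (of_int (g ^ k) - of_int (g ^ b)) / (of_int (g ^ a) - of_int (g ^ b))))"
          using T y K gk unfolding FR_def
          by (intro square_values_interpolated[OF g s P[unfolded FR_def] _ large finU U(2)])
             (auto simp: h_def)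
        hence "complex_of_real (real_of_int (y k)) = complex_of_real (\<Sum>a\<in>U. of_int (y a) *
           (\<Prod>b\<in>U - {a}. (of_int (g ^ k) - of_int (g ^ b)) / (of_int (g ^ a) - of_int (g ^ b))))"
          by (rule arg_cong)
        thus ?thesis unfolding p(2) by simp
      qed
      have "card ((\<lambda>a. complex_of_int (g ^ a)) ` T) = card T" by (rule card_image[OF inj])
      moreover have "degree (smult (of_int s) (p ^ 2)) \<le> 2 * d"
        using p(1) U(2) degree_power_le[of p 2] by (intro order.trans[OF degree_smult_le]) simp
      moreover have "degree (map_poly complex_of_int F) = 2 * d"
        using F by (simp add: degree_map_poly)
      moreover have "poly (map_poly of_int F) x = poly (smult (of_int s) (p ^ 2)) x"
        if "x \<in> (\<lambda>a. complex_of_int (g ^ a)) ` T" for x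
      proof -
        from that obtain k where k: "k \<in> T" "x = of_int (g ^ k)" by blast
        have "poly (map_poly of_int F) x = complex_of_int (poly F (g ^ k))"
          unfolding k(2) by (rule poly_map_of_int_eq)
        also have "\<dots> = of_int s * of_int (y k) ^ 2" using y[OF k(1)] by simp
        finally show ?thesis by (simp only: poly_smult poly_power k(2) py[OF k(1)])
      qed
      ultimately have "map_poly of_int F = smult (of_int s) (p ^ 2)"
        using card by (intro poly_eqI_degree[of "(\<lambda>a. complex_of_int (g ^ a)) ` T"]) auto
      thus False using nonsquare by blast
    qed
  qed simp
qed

section \<open>Covering an interval by multiplicative windows\<close>

text \<open>The elements from \<open>K\<close> on are grouped by the integer part of their logarithm
  to base \<open>1 + 1 / B\<close>. Each group lies in the window that starts at its minimum, so it
  has at most \<open>w\<close> elements, and the number of groups is logarithmic in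
  \<open>N\<close>.\<close>

lemma card_le_ln_if_sparse_windows:
  fixes T :: "nat set"
  assumes BK: "B > 0" "K > 0" and N: "N \<ge> 1"
    and window: "\<And>k0 T'. k0 \<ge> K \<Longrightarrow> T' \<subseteq> T \<Longrightarrow> T' \<subseteq> {k0..k0 + k0 div B} \<Longrightarrow> card T' \<le> w"
    and spread: "\<And>k k'. k \<in> T \<Longrightarrow> k' \<in> T \<Longrightarrow> k' < k + N"
  shows "real (card T) \<le> real K + real w * (ln (real N) / ln (1 + 1 / real B) + 2)"
proof -
  define c where "c = ln (1 + 1 / real B)"
  have c: "c > 0" unfolding c_def using BK by (intro ln_gt_zero) simp
  have finT: "finite T"
  proof (cases "T = {}")
    case False
    then obtain k where "k \<in> T" by blast
    hence "T \<subseteq> {..<k + N}" using spread by auto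
    thus ?thesis using finite_subset by blast
  qed simp
  define T1 where "T1 = {k \<in> T. k \<ge> K}"
  define lev where "lev k = \<lfloor>ln (real k) / c\<rfloor>" for k :: nat
  define J where "J = lev ` T1"
  have finT1: "finite T1" using finT by (simp add: T1_def)
  have T1D: "k \<in> T" "k \<ge> K" "k > 0" if "k \<in> T1" for k using that BK by (auto simp: T1_def)
  have fiber: "card {k \<in> T1. lev k = j} \<le> w" for j
  proof (cases "{k \<in> T1. lev k = j} = {}")
    case False
    define k0 where "k0 = Min {k \<in> T1. lev k = j}"
    have "k0 \<in> {k \<in> T1. lev k = j}" unfolding k0_def using False finT1 by (intro Min_in) auto
    hence k0: "k0 \<in> T1" "lev k0 = j" by auto
    have "k \<in> {k0..k0 + k0 div B}" if k: "k \<in> T1" "lev k = j" for k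
    proof -
      have "k0 \<le> k" unfolding k0_def using finT1 k by (intro Min_le) auto
      have "ln (real k) / c < ln (real k0) / c + 1"
        using k(2) k0(2) unfolding lev_def by linarith
      hence "ln (real k) < ln (real k0) + c" using c by (simp add: field_simps)
      also have "\<dots> = ln (real k0 * (1 + 1 / real B))"
        unfolding c_def using BK T1D(3)[OF k0(1)] by (intro ln_mult_pos[symmetric]) (auto intro: add_pos_nonneg)
      finally have "real k < real k0 * (1 + 1 / real B)"
        using T1D(3)[OF k(1)] T1D(3)[OF k0(1)] BK
        by (subst (asm) ln_less_cancel_iff) (auto intro!: mult_pos_pos add_pos_nonneg)
      hence "real k * real B < real k0 * (1 + 1 / real B) * real B"
        using BK by (intro mult_strict_right_mono) auto
      also have "\<dots> = real k0 * real B + real k0" using BK by (simp add: distrib_left distrib_right)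
      finally have "real k * real B < real k0 * real B + real k0" .
      hence "real (k * B) < real (k0 * B + k0)" by simp
      hence "k * B < k0 * B + k0" by (simp only: of_nat_less_iff)
      hence "(k - k0) * B \<le> k0" by (simp add: diff_mult_distrib)
      hence "k - k0 \<le> k0 div B" using BK by (simp add: less_eq_div_iff_mult_less_eq)
      thus ?thesis using \<open>k0 \<le> k\<close> by auto
    qed
    thus ?thesis using T1D[OF k0(1)] T1D by (intro window[of k0]) auto
  next
    case True
    show ?thesis unfolding True by simp
  qed
  have "card T1 \<le> card (\<Union>j\<in>J. {k \<in> T1. lev k = j})"
    using finT1 by (intro card_mono) (auto simp: J_def)
  also have "\<dots> \<le> (\<Sum>j\<in>J. card {k \<in> T1. lev k = j})"
    using finT1 by (intro card_UN_le) (auto simp: J_def)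
  also have "\<dots> \<le> (\<Sum>j\<in>J. w)" by (intro sum_mono fiber)
  finally have cardT1: "card T1 \<le> card J * w" by simp
  have lnN: "ln (real N) \<ge> 0" using N by simp
  have "real (card J) \<le> ln (real N) / c + 2"
  proof (cases "T1 = {}")
    case False
    define m where "m = Min T1"
    have m: "m \<in> T1" unfolding m_def using False finT1 by (intro Min_in)
    have "J \<subseteq> {lev m..\<lfloor>ln (real m) / c + ln (real N) / c\<rfloor>}"
      unfolding J_def
    proof (intro subsetI, elim imageE)
      fix j k assume k: "j = lev k" "k \<in> T1"
      have "m \<le> k" unfolding m_def using finT1 k by (intro Min_le) auto
      hence "ln (real m) / c \<le> ln (real k) / c"
        using T1D(3)[OF m] c by (intro divide_right_mono) auto
      \<comment> \<open>From \<open>k \<le> m + N - 1 \<le> m * N\<close>, valid as \<open>m\<close>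
        and \<open>N\<close> are positive. The levels thus spread over at most
        \<open>ln N / c\<close> wherever \<open>T\<close> lies, which later gives uniformity in
        \<open>M\<close>.\<close>
      moreover have "k \<le> m * N"
      proof -
        have "k + 1 \<le> m + N" using spread[OF T1D(1)[OF m] T1D(1)[OF k(2)]] by simp
        moreover obtain m' N' where "m = Suc m'" "N = Suc N'"
          using T1D(3)[OF m] N by (metis Suc_le_D One_nat_def gr0_implies_Suc)
        ultimately show ?thesis by simp
      qed
      hence "real k \<le> real m * real N" by (metis of_nat_le_iff of_nat_mult)
      hence "ln (real k) \<le> ln (real m * real N)"
        using T1D(3)[OF m] T1D(3)[OF k(2)] N by (subst ln_le_cancel_iff) auto
      hence "ln (real k) / c \<le> (ln (real m) + ln (real N)) / c"
        using T1D(3)[OF m] N c by (intro divide_right_mono) (auto simp: ln_mult_pos)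
      hence "ln (real k) / c \<le> ln (real m) / c + ln (real N) / c" by (simp add: add_divide_distrib)
      ultimately show "j \<in> {lev m..\<lfloor>ln (real m) / c + ln (real N) / c\<rfloor>}"
        using k(1) by (auto simp: lev_def intro: floor_mono)
    qed
    hence "card J \<le> card {lev m..\<lfloor>ln (real m) / c + ln (real N) / c\<rfloor>}"
      by (intro card_mono) auto
    also have "\<dots> = nat (\<lfloor>ln (real m) / c + ln (real N) / c\<rfloor> - lev m + 1)" by simp
    finally have "real (card J) \<le> real (nat (\<lfloor>ln (real m) / c + ln (real N) / c\<rfloor> - lev m + 1))"
      by simp
    \<comment> \<open>One unit comes from rounding down \<open>lev m\<close>, one from counting both
      end points.\<close>
    also have "\<dots> \<le> ln (real N) / c + 2"
    proof -
      have "ln (real N) / c \<ge> 0" using lnN c by simp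
      thus ?thesis unfolding lev_def by linarith
    qed
    finally show ?thesis .
  qed (use lnN c in \<open>simp add: J_def\<close>)
  hence "real (card J * w) \<le> real w * (ln (real N) / c + 2)"
    by (simp add: mult.commute mult_left_mono)
  moreover have "card T \<le> card ({..<K} \<union> T1)"
    using finT1 by (intro card_mono) (auto simp: T1_def)
  hence "card T \<le> K + card T1" using card_Un_le[of "{..<K}" T1] by simp
  hence "real (card T) \<le> real K + real (card J * w)" using cardT1 by linarith
  ultimately show ?thesis unfolding c_def by linarith
qed

section \<open>Simple roots exclude constant multiples of squares\<close>

lemma poly_eqI_of_int:
  fixes p q :: "'a::{idom, ring_char_0} poly"
  assumes "\<And>x. poly p (of_int x) = poly q (of_int x)"
  shows "p = q"
proof (rule ccontr)
  assume "p \<noteq> q"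
  hence "finite {x. poly (p - q) x = 0}" by (intro poly_roots_finite) simp
  moreover have "range (of_int :: int \<Rightarrow> 'a) \<subseteq> {x. poly (p - q) x = 0}" using assms by auto
  ultimately have "finite (range (of_int :: int \<Rightarrow> 'a))" using finite_subset by blast
  thus False by (simp add: finite_image_iff inj_on_def infinite_UNIV_int)
qed

text \<open>Without multiple roots the degree is the number of distinct roots, and at most one of
  them is 0.\<close>

lemma rsquarefree_nonzero_root:
  fixes p :: "complex poly"
  assumes "rsquarefree p" "degree p \<ge> 2"
  shows "\<exists>z. z \<noteq> 0 \<and> poly p z = 0"
proof (rule ccontr)
  assume "\<not> ?thesis"
  hence sub: "{z. poly p z = 0} \<subseteq> {0}" by auto
  have "degree p = degree (smult (lead_coeff p) (\<Prod>z | poly p z = 0. [:- z, 1:]))"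
    using complex_poly_decompose_rsquarefree[OF assms(1)] by simp
  also have "\<dots> \<le> degree (\<Prod>z | poly p z = 0. [:- z, 1:])" by (rule degree_smult_le)
  also have "\<dots> \<le> (\<Sum>z | poly p z = 0. 1)"
    using degree_prod_sum_le[of "{z. poly p z = 0}" "\<lambda>z. [:- z, 1:]"] finite_subset[OF sub] by simp
  also have "\<dots> \<le> card {0 :: complex}" using card_mono[OF _ sub] by simp
  finally show False using assms(2) by simp
qed

text \<open>A nonzero root \<open>z\<close> of \<open>f\<close> lifts to some
  \<open>y \<noteq> 0\<close> with \<open>a * y ^ 2 = z\<close>, where the derivative of the
  composition is \<open>f'(z) * 2 * a * y \<noteq> 0\<close>. A zero of \<open>c * p ^ 2\<close> is
  never simple. A root of \<open>f\<close> at 0 would not do, since it lifts to a double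
  root.\<close>

lemma pcompose_scaled_square_not_square:
  fixes f :: "int poly" and a :: int
  assumes "rsquarefree (map_poly of_int f :: complex poly)" "degree f \<ge> 2" "a \<noteq> 0"
  shows "map_poly of_int (f \<circ>\<^sub>p [:0, 0, a:]) \<noteq> smult (c :: complex) (p ^ 2)"
proof
  define fc :: "complex poly" where "fc = map_poly of_int f"
  define q :: "complex poly" where "q = [:0, 0, of_int a:]"
  assume "map_poly of_int (f \<circ>\<^sub>p [:0, 0, a:]) = smult c (p ^ 2)"
  moreover have "map_poly of_int (f \<circ>\<^sub>p [:0, 0, a:]) = fc \<circ>\<^sub>p q"
  proof (rule poly_eqI_of_int)
    fix x :: int
    have "poly (fc \<circ>\<^sub>p q) (of_int x) = poly fc (of_int (poly [:0, 0, a:] x))"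
      by (simp add: poly_pcompose q_def)
    thus "poly (map_poly of_int (f \<circ>\<^sub>p [:0, 0, a:])) (of_int x) = poly (fc \<circ>\<^sub>p q) (of_int x)"
      by (simp only: fc_def poly_map_of_int_eq poly_pcompose)
  qed
  ultimately have eq: "fc \<circ>\<^sub>p q = smult c (p ^ 2)" by simp
  have "degree fc = degree f" unfolding fc_def by (rule degree_map_poly) simp
  then obtain z where z: "z \<noteq> 0" "poly fc z = 0"
    using rsquarefree_nonzero_root assms(1,2) unfolding fc_def by metis
  hence z': "poly (pderiv fc) z \<noteq> 0" using assms(1) by (simp add: fc_def rsquarefree_roots)
  define y where "y = csqrt (z / of_int a)"
  have "y ^ 2 * of_int a = z" using assms(3) by (simp add: y_def)
  hence y: "poly q y = z" "y \<noteq> 0" using z(1) by (auto simp: q_def power2_eq_square algebra_simps)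
  have "c * poly p y ^ 2 = 0"
    using arg_cong[OF eq, of "\<lambda>r. poly r y"] z y by (simp add: poly_pcompose)
  \<comment> \<open>The factor \<open>c\<close> is kept because it may be 0.\<close>
  hence "c * poly p y = 0" by auto
  hence "poly (pderiv (smult c (p ^ 2))) y = 0"
    by (auto simp: power2_eq_square pderiv_smult pderiv_mult)
  moreover have "poly (pderiv (fc \<circ>\<^sub>p q)) y = poly (pderiv fc) z * (2 * of_int a * y)"
    by (simp add: pderiv_pcompose poly_pcompose y) (simp add: q_def pderiv_pCons)
  ultimately show False using eq z' y assms(3) by simp
qed

section \<open>The logarithmic bound for one squarefree part\<close>

text \<open>Fixing the offset \<open>r\<close> turns \<open>g ^ (2 * k + r)\<close> into
  \<open>g ^ r * x ^ 2\<close> at \<open>x = g ^ k\<close>. The composed polynomial has even degree,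
  as completing the square requires, and is no constant times a square.\<close>

lemma square_multiples_at_powers_bound:
  fixes f :: "int poly" and g :: int
  assumes g: "g > 1" and f: "degree f \<ge> 2" "lead_coeff f > 0"
    and sqf: "rsquarefree (map_poly of_int f :: complex poly)"
  shows "\<exists>C\<ge>0. \<forall>s T N. s \<ge> 1 \<longrightarrow> N \<ge> 1 \<longrightarrow> (\<forall>k\<in>T. \<exists>y. poly f (g ^ (2 * k + r)) = s * y ^ 2) \<longrightarrow>
     (\<forall>k\<in>T. \<forall>k'\<in>T. k' < k + N) \<longrightarrow> real (card T) \<le> C * (1 + ln (real N))"
proof -
  define F where "F = f \<circ>\<^sub>p [:0, 0, g ^ r:]"
  define d where "d = degree f"
  have q: "degree [:0, 0, g ^ r:] = 2" "lead_coeff [:0, 0, g ^ r:] = g ^ r" using g by auto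
  have F: "degree F = 2 * d" by (simp only: F_def d_def degree_pcompose q mult.commute)
  have "lead_coeff F = lead_coeff f * (g ^ r) ^ d"
    unfolding F_def d_def by (subst lead_coeff_comp) (use q in auto)
  hence lcF: "lead_coeff F > 0" using f(2) g by simp
  have FE: "poly F (g ^ k) = poly f (g ^ (2 * k + r))" for k
  proof -
    have "poly F (g ^ k) = poly f (g ^ k * (g ^ k * g ^ r))" by (simp add: F_def poly_pcompose)
    also have "g ^ k * (g ^ k * g ^ r) = g ^ (2 * k + r)" by (simp add: power_add mult_2)
    finally show ?thesis .
  qed
  have d1: "d \<ge> 1" using f(1) by (simp add: d_def)
  have "g ^ r \<noteq> 0" using g by simp
  hence nonsquare: "map_poly of_int F \<noteq> smult (c :: complex) (p ^ 2)" for c p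
    unfolding F_def by (rule pcompose_scaled_square_not_square[OF sqf f(1)])
  obtain B K :: nat where BK: "B > 0" "K > 0"
    "\<And>s k0 T. s \<ge> 1 \<Longrightarrow> k0 \<ge> K \<Longrightarrow> T \<subseteq> {k0..k0 + k0 div B} \<Longrightarrow>
       \<forall>k\<in>T. \<exists>y. poly F (g ^ k) = s * y ^ 2 \<Longrightarrow> card T \<le> 2 * d"
    using few_square_multiples_in_window[OF g F lcF d1 nonsquare] by metis
  define c where "c = ln (1 + 1 / real B)"
  have c: "c > 0" unfolding c_def using BK by (intro ln_gt_zero) simp
  \<comment> \<open>Large enough for \<open>K + 2 * d * (L / c + 2) \<le> C * (1 + L)\<close>
    whenever \<open>L \<ge> 0\<close>.\<close>
  define C where "C = real K + real (2 * d) * (1 / c + 2)"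
  show ?thesis
  proof (intro exI[of _ C] conjI allI impI)
    show "C \<ge> 0" using c by (simp add: C_def)
    fix s T and N :: nat
    assume s: "s \<ge> 1" and N: "N \<ge> 1"
      and T: "\<forall>k\<in>T. \<exists>y. poly f (g ^ (2 * k + r)) = s * y ^ 2"
        "\<forall>k\<in>T. \<forall>k'\<in>T. k' < k + N"
    have L: "ln (real N) \<ge> 0" using N by simp
    have "real (card T) \<le> real K + real (2 * d) * (ln (real N) / c + 2)"
      unfolding c_def
    proof (rule card_le_ln_if_sparse_windows[OF BK(1,2) N])
      fix k0 T' assume "k0 \<ge> K" "T' \<subseteq> T" "T' \<subseteq> {k0..k0 + k0 div B}"
      thus "card T' \<le> 2 * d" using T(1) by (intro BK(3)[OF s]) (auto simp: FE)
    qed (use T(2) in auto)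
    also have "\<dots> \<le> real K * (1 + ln (real N)) + real (2 * d) * ((1 / c + 2) * (1 + ln (real N)))"
    proof (intro add_mono mult_left_mono)
      show "real K \<le> real K * (1 + ln (real N))" using L by (simp add: algebra_simps)
      have "(1 / c + 2) * (1 + ln (real N)) = ln (real N) / c + 2 + (1 / c + 2 * ln (real N))"
        by (simp add: distrib_left distrib_right)
      moreover have "1 / c + 2 * ln (real N) \<ge> 0" using L c by simp
      ultimately show "ln (real N) / c + 2 \<le> (1 / c + 2) * (1 + ln (real N))" by linarith
    qed auto
    also have "\<dots> = C * (1 + ln (real N))" by (simp only: C_def distrib_right mult.assoc)
    finally show "real (card T) \<le> C * (1 + ln (real N))" .
  qed
qed

section \<open>Counting quadratic fields\<close>

text \<open>Even and odd \<open>n\<close> are counted separately, as \<open>2 * k\<close> and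
  \<open>2 * k + 1\<close>; equality of the fields makes each value \<open>s\<close> times a
  square.\<close>

lemma quad_count_bound:
  fixes f :: "int poly" and g :: int
  assumes g: "g > 1" and f: "degree f \<ge> 2" "lead_coeff f > 0"
    and sqf: "rsquarefree (map_poly of_int f :: complex poly)"
  obtains C where "C \<ge> 1"
    "\<And>M N s. N \<ge> 1 \<Longrightarrow> s \<ge> 1 \<Longrightarrow> squarefree s \<Longrightarrow>
       real (quad_count (\<lambda>n. poly f (g ^ n)) M N s) \<le> C * (1 + ln (real N))"
proof -
  obtain C where C: "\<And>r. C r \<ge> 0"
    "\<And>r s T N. s \<ge> 1 \<Longrightarrow> N \<ge> 1 \<Longrightarrow> \<forall>k\<in>T. \<exists>y. poly f (g ^ (2 * k + r)) = s * y ^ 2 \<Longrightarrow>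
       \<forall>k\<in>T. \<forall>k'\<in>T. k' < k + N \<Longrightarrow> real (card T) \<le> C r * (1 + ln (real N))"
    using square_multiples_at_powers_bound[OF assms] by metis
  show ?thesis
  \<comment> \<open>The summand 1 gives \<open>C \<ge> 1\<close>, so that the bound is at least 1
    and its logarithm can serve as an exponent of \<open>N\<close>.\<close>
  proof (rule that[of "C 0 + C 1 + 1"])
    show "C 0 + C 1 + 1 \<ge> 1" using C(1)[of 0] C(1)[of 1] by simp
    fix M s :: int and N :: nat
    assume N: "N \<ge> 1" and s: "s \<ge> 1" "squarefree s"
    define A where "A = {n :: nat. n \<ge> 1 \<and> int n \<in> {M + 1..M + int N} \<and>
      quadratic_field (poly f (g ^ n)) = quadratic_field s}"
    define T where "T r = {k. 2 * k + r \<in> A}" for r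
    have bound: "real (card (T r)) \<le> C r * (1 + ln (real N))" for r
    proof (rule C(2)[OF s(1) N])
      show "\<forall>k\<in>T r. \<exists>y. poly f (g ^ (2 * k + r)) = s * y ^ 2"
        using s same_quadratic_field_imp_square_multiple by (auto simp: T_def A_def)
      show "\<forall>k\<in>T r. \<forall>k'\<in>T r. k' < k + N" by (auto simp: T_def A_def)
    qed
    have finA: "finite A"
    proof (rule finite_subset)
      show "A \<subseteq> {..nat (M + int N)}" by (auto simp: A_def)
    qed simp
    have finT: "finite (T r)" for r
      unfolding T_def using finite_vimageI[OF finA, of "\<lambda>k. 2 * k + r"]
      by (auto simp: inj_on_def vimage_def)
    have "A \<subseteq> (\<lambda>k. 2 * k) ` T 0 \<union> (\<lambda>k. 2 * k + 1) ` T 1"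
    proof
      fix n assume "n \<in> A"
      thus "n \<in> (\<lambda>k. 2 * k) ` T 0 \<union> (\<lambda>k. 2 * k + 1) ` T 1"
        by (cases "even n") (auto simp: T_def elim!: evenE oddE)
    qed
    hence "card A \<le> card ((\<lambda>k. 2 * k) ` T 0 \<union> (\<lambda>k. 2 * k + 1) ` T 1)"
      using finT by (intro card_mono) auto
    also have "\<dots> \<le> card ((\<lambda>k. 2 * k) ` T 0) + card ((\<lambda>k. 2 * k + 1) ` T 1)" by (rule card_Un_le)
    also have "\<dots> \<le> card (T 0) + card (T 1)" by (intro add_mono card_image_le finT)
    finally have "real (card A) \<le> real (card (T 0)) + real (card (T 1))" by linarith
    also have "\<dots> \<le> (C 0 + C 1) * (1 + ln (real N))"
      using bound[of 0] bound[of 1] by (simp add: algebra_simps)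
    also have "\<dots> \<le> (C 0 + C 1 + 1) * (1 + ln (real N))"
      using N by (intro mult_right_mono) auto
    finally show "real (quad_count (\<lambda>n. poly f (g ^ n)) M N s) \<le> (C 0 + C 1 + 1) * (1 + ln (real N))"
      by (simp add: quad_count_def A_def)
  qed
qed

lemma quad_count_total_le:
  assumes "\<And>s. s \<ge> 1 \<Longrightarrow> squarefree s \<Longrightarrow> real (quad_count u M N s) \<le> b" "b \<ge> 0"
  shows "real (quad_count_total u M N S) \<le> real S * b"
proof -
  have "real (quad_count_total u M N S) = (\<Sum>s | s \<in> {1..int S} \<and> squarefree s. real (quad_count u M N s))"
    by (simp add: quad_count_total_def)
  also have "\<dots> \<le> (\<Sum>s | s \<in> {1..int S} \<and> squarefree s. b)"
    using assms(1) by (intro sum_mono) auto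
  also have "\<dots> = real (card {s. s \<in> {1..int S} \<and> squarefree s}) * b" by simp
  also have "\<dots> \<le> real S * b"
  proof (rule mult_right_mono)
    have "card {s. s \<in> {1..int S} \<and> squarefree s} \<le> card {1..int S}" by (intro card_mono) auto
    thus "real (card {s. s \<in> {1..int S} \<and> squarefree s}) \<le> real S" by simp
  qed fact
  finally show ?thesis .
qed

text \<open>For \<open>N = 1\<close> every power of \<open>N\<close> is 1, so no constant can be
  absorbed into an exponent and the exact value matters.\<close>

lemma quad_count_total_1_1: "quad_count_total u M 1 1 \<le> 1"
proof -
  have "{s :: int. s \<in> {1..int 1} \<and> squarefree s} = {1}" by auto
  hence "quad_count_total u M 1 1 = quad_count u M 1 1" by (simp add: quad_count_total_def)
  also have "\<dots> \<le> card {nat (M + 1)}" unfolding quad_count_def by (intro card_mono) auto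
  finally show ?thesis by simp
qed

section \<open>The range of the exponent and comparison with the three bounds\<close>

text \<open>A prime divisor of \<open>l - 1\<close> is smaller than \<open>l\<close>, so for
  \<open>\<alpha> \<ge> 1\<close> no prime is counted, and the zero function has no lower bound of
  order \<open>z / ln z\<close>.\<close>

lemma shifted_prime_exponent_less_1:
  assumes "(\<lambda>z::real. real (shifted_prime_count \<alpha> z)) \<in> \<Omega>(\<lambda>z. z / ln z)"
  shows "\<alpha> < 1"
proof (rule ccontr)
  assume \<alpha>: "\<not> \<alpha> < 1"
  have small: "\<not> real l powr \<alpha> \<le> real (largest_prime_divisor (l - 1))" if "l > 2" for l
  proof -
    have "l - 1 \<noteq> 0" "l - 1 \<noteq> 1" using that by auto
    then obtain p where "prime p" "p dvd l - 1" using prime_factor_nat by blast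
    hence "p \<in> prime_factors (l - 1)" using \<open>l - 1 \<noteq> 0\<close> by (intro prime_factorsI) auto
    hence "prime_factors (l - 1) \<noteq> {}" by blast
    hence "largest_prime_divisor (l - 1) \<in> prime_factors (l - 1)"
      unfolding largest_prime_divisor_def by (intro Max_in) auto
    hence "largest_prime_divisor (l - 1) \<le> l - 1" using that by (intro dvd_imp_le) auto
    hence "real (largest_prime_divisor (l - 1)) < real l powr 1" using that by simp
    also have "\<dots> \<le> real l powr \<alpha>" using \<alpha> that by (intro powr_mono) auto
    finally show ?thesis by simp
  qed
  have "{l. prime l \<and> l > 2 \<and> real l \<le> z \<and>
      real (largest_prime_divisor (l - 1)) \<ge> real l powr \<alpha>} = {}" for z
    using small by blast
  hence "shifted_prime_count \<alpha> z = 0" for z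
    by (simp only: shifted_prime_count_def card.empty)
  with assms have "(\<lambda>z::real. 0 :: real) \<in> \<Omega>(\<lambda>z. z / ln z)" by simp
  then obtain c where c: "c > 0" "\<forall>\<^sub>F z::real in at_top. norm (0::real) \<ge> c * norm (z / ln z)"
    by (elim landau_omega.bigE)
  have "\<forall>\<^sub>F z::real in at_top. False"
    using c(2) eventually_gt_at_top[of 1]
  proof eventually_elim
    case (elim z)
    hence "c * \<bar>z / ln z\<bar> > 0" using c(1) by simp
    thus False using elim by simp
  qed
  thus False by simp
qed

text \<open>Splits \<open>x\<close> as \<open>x powr (1 - b) * x powr b\<close> and trades the
  second factor for a power of \<open>n\<close>; this brings the trivial bound \<open>S\<close> into
  the shape of the claimed ones.\<close>

lemma le_powr_mult_powr:
  fixes x n a b c :: real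
  assumes "x \<ge> 1" "n \<ge> 1" "x \<le> n powr a" "b \<ge> 0" "a * b \<le> c"
  shows "x \<le> x powr (1 - b) * n powr c"
proof -
  have "x powr b \<le> (n powr a) powr b" using assms by (intro powr_mono2) auto
  also have "\<dots> \<le> n powr c" using assms by (simp add: powr_powr powr_mono)
  finally have "x powr (1 - b) * x powr b \<le> x powr (1 - b) * n powr c" by (intro mult_left_mono) auto
  moreover have "x powr (1 - b) * x powr b = x" using assms(1) by (simp flip: powr_add)
  ultimately show ?thesis by simp
qed

theorem corollary1p4:
  fixes g :: int and f :: "int poly" and \<alpha> :: real and u :: "nat \<Rightarrow> int"
  assumes "g > 1"
    and "degree f \<ge> 3"
    and "lead_coeff f > 0"
    and "rsquarefree (map_poly of_int f :: complex poly)"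
    and u: "u = (\<lambda>n. poly f (g ^ n))"
    and "\<alpha> > 0"
    and "(\<lambda>z::real. real (shifted_prime_count \<alpha> z)) \<in> \<Omega>(\<lambda>z. z / ln z)"
  shows "\<exists>\<epsilon>1 \<epsilon>2 \<epsilon>3 :: nat \<Rightarrow> real.
    \<epsilon>1 \<longlonglongrightarrow> 0 \<and> \<epsilon>2 \<longlonglongrightarrow> 0 \<and> \<epsilon>3 \<longlonglongrightarrow> 0 \<and>
    (\<forall>(M :: int) (N :: nat) (S :: nat). N \<ge> 1 \<longrightarrow> S \<ge> 1 \<longrightarrow>
      (real S \<le> real N powr (2 * (1 - \<alpha>) / (1 + 3 * \<alpha>)) \<longrightarrow>
        real (quad_count_total u M N S)
          \<le> real S powr (1 - 1 / (4 * \<alpha>)) * real N powr (1 / (2 * \<alpha>) + \<epsilon>1 N)) \<and>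
      (real N powr (2 * (1 - \<alpha>) / (1 + 3 * \<alpha>)) < real S \<and>
       real S \<le> real N powr (4 * (1 - \<alpha>) / (1 + 3 * \<alpha>)) \<longrightarrow>
        real (quad_count_total u M N S)
          \<le> real S powr (1 / 2) * real N powr ((3 - \<alpha>) / (1 + 3 * \<alpha>) + \<epsilon>2 N)) \<and>
      (real N powr (4 * (1 - \<alpha>) / (1 + 3 * \<alpha>)) < real S \<and>
       real S \<le> real N powr (2 * \<alpha> / 3) \<longrightarrow>
        real (quad_count_total u M N S)
          \<le> real S powr (3 / (3 + \<alpha>)) * real N powr ((3 - \<alpha>) / (3 + \<alpha>) + \<epsilon>3 N)))"
proof -
  have \<alpha>: "0 < \<alpha>" "\<alpha> < 1" using assms shifted_prime_exponent_less_1 by auto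
  have "degree f \<ge> 2" using assms(2) by simp
  then obtain C where C: "C \<ge> 1"
    "\<And>M N s. N \<ge> 1 \<Longrightarrow> s \<ge> 1 \<Longrightarrow> squarefree s \<Longrightarrow>
       real (quad_count u M N s) \<le> C * (1 + ln (real N))"
    using quad_count_bound[OF assms(1) _ assms(3,4)] unfolding u by blast
  \<comment> \<open>Chosen so that \<open>N powr \<epsilon> N\<close> equals the bound
    \<open>C * (1 + ln N)\<close> for \<open>N > 1\<close>. At \<open>N = 1\<close> the quotient has
    denominator 0 and value 0.\<close>
  define \<epsilon> where "\<epsilon> N = ln (C * (1 + ln (real N))) / ln (real N)" for N :: nat
  have "C > 0" using C(1) by simp
  hence lim: "\<epsilon> \<longlonglongrightarrow> 0" unfolding \<epsilon>_def by real_asymp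
  \<comment> \<open>The three ranges are instances with \<open>b\<close> equal to
    \<open>1 / (4 * \<alpha>)\<close>, \<open>1 / 2\<close> and
    \<open>\<alpha> / (3 + \<alpha>)\<close>, and with \<open>a\<close> the exponent bounding
    \<open>S\<close> from above.\<close>
  have total: "real (quad_count_total u M N S) \<le> real S powr (1 - b) * real N powr (c + \<epsilon> N)"
    if NS: "N \<ge> 1" "S \<ge> 1" "real S \<le> real N powr a" and b: "b \<ge> 0" "a * b \<le> c" for M N S a b c
  \<comment> \<open>Here \<open>S \<le> 1 powr a = 1\<close>, so both sides are settled
    directly.\<close>
  proof (cases "N = 1")
    case True
    hence "S = 1" using NS by simp
    thus ?thesis using True quad_count_total_1_1[of u M] by simp
  next
    case False
    define t where "t = C * (1 + ln (real N))"
    have N: "ln (real N) > 0" using NS(1) False by simp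
    hence "1 * 1 \<le> t" unfolding t_def using C(1) by (intro mult_mono) auto
    hence t: "t > 0" by simp
    have "real N powr \<epsilon> N = t" using N t NS(1) by (simp add: \<epsilon>_def t_def powr_def)
    have "real (quad_count_total u M N S) \<le> real S * t"
      using C(2)[OF NS(1)] t unfolding t_def by (intro quad_count_total_le) auto
    also have "\<dots> \<le> real S powr (1 - b) * real N powr c * t"
      using le_powr_mult_powr[OF _ _ NS(3) b] NS t by (intro mult_right_mono) auto
    also have "\<dots> = real S powr (1 - b) * real N powr (c + \<epsilon> N)"
      using \<open>real N powr \<epsilon> N = t\<close> by (simp add: powr_add mult.assoc)
    finally show ?thesis .
  qed
  have e1: "2 * (1 - \<alpha>) / (1 + 3 * \<alpha>) * (1 / (4 * \<alpha>)) \<le> 1 / (2 * \<alpha>)"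
  proof -
    have "2 * (1 - \<alpha>) / (1 + 3 * \<alpha>) \<le> 2" using \<alpha> by (simp add: divide_le_eq)
    hence "2 * (1 - \<alpha>) / (1 + 3 * \<alpha>) * (1 / (4 * \<alpha>)) \<le> 2 * (1 / (4 * \<alpha>))"
      using \<alpha> by (intro mult_right_mono) auto
    thus ?thesis by simp
  qed
  have e2: "4 * (1 - \<alpha>) / (1 + 3 * \<alpha>) * (1 / 2) \<le> (3 - \<alpha>) / (1 + 3 * \<alpha>)"
    using \<alpha> by (simp add: field_simps)
  \<comment> \<open>For \<open>\<alpha> < 1\<close> the numerator on the left is at most
    \<open>2 / 3\<close>, while \<open>3 - \<alpha>\<close> exceeds 2.\<close>
  have e3: "2 * \<alpha> / 3 * (\<alpha> / (3 + \<alpha>)) \<le> (3 - \<alpha>) / (3 + \<alpha>)"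
  proof -
    have "\<alpha> * \<alpha> \<le> 1 * 1" using \<alpha> by (intro mult_mono) auto
    hence "2 * \<alpha> / 3 * \<alpha> \<le> 3 - \<alpha>" using \<alpha> by simp
    hence "(2 * \<alpha> / 3 * \<alpha>) / (3 + \<alpha>) \<le> (3 - \<alpha>) / (3 + \<alpha>)" using \<alpha> by (intro divide_right_mono) auto
    thus ?thesis by simp
  qed
  have x3: "1 - \<alpha> / (3 + \<alpha>) = 3 / (3 + \<alpha>)" using \<alpha> by (simp add: field_simps)
  have x2: "1 - 1 / 2 = (1 / 2 :: real)" by simp
  \<comment> \<open>The same \<open>\<epsilon>\<close> serves all three ranges.\<close>
  show ?thesis
  proof (intro exI[of _ \<epsilon>] conjI allI impI lim; (elim conjE)?)
    fix M :: int and N S :: nat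
    assume NS: "N \<ge> 1" "S \<ge> 1"
    show "real (quad_count_total u M N S)
          \<le> real S powr (1 - 1 / (4 * \<alpha>)) * real N powr (1 / (2 * \<alpha>) + \<epsilon> N)"
      if "real S \<le> real N powr (2 * (1 - \<alpha>) / (1 + 3 * \<alpha>))"
      using total[OF NS that _ e1] \<alpha> by simp
    show "real (quad_count_total u M N S)
          \<le> real S powr (1 / 2) * real N powr ((3 - \<alpha>) / (1 + 3 * \<alpha>) + \<epsilon> N)"
      if "real S \<le> real N powr (4 * (1 - \<alpha>) / (1 + 3 * \<alpha>))"
      using total[OF NS that _ e2, unfolded x2] by simp
    show "real (quad_count_total u M N S)
          \<le> real S powr (3 / (3 + \<alpha>)) * real N powr ((3 - \<alpha>) / (3 + \<alpha>) + \<epsilon> N)"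
      if "real S \<le> real N powr (2 * \<alpha> / 3)"
      using total[OF NS that _ e3, unfolded x3] \<alpha> by simp
  qed
qed

end
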